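(* Let $N\in\mathbb N$ and let the tetradiagonal Hessenberg matrix $T^{[N]}\in\mathbb R^{(N+1)\times(N+1)}$ be oscillatory. Then each real $\alpha_2<\mathcal K[N,1]$ determines a positive sequence $\{\alpha_1,\alpha_3,\alpha_4,\alpha_5,\dots,\alpha_{3N+1}\}$ such that $T^{[N]}=L_1^{[N]}L_2^{[N]}U^{[N]}$, where $L_1^{[N]}$ is lower unitriangular bidiagonal with first subdiagonal $(\alpha_2,\alpha_5,\dots,\alpha_{3N-1})$, $L_2^{[N]}$ is lower unitriangular bidiagonal with first subdiagonal $(\alpha_3,\alpha_6,\dots,\alpha_{3N})$, and $U^{[N]}$ is upper bidiagonal with diagonal $(\alpha_1,\alpha_4,\dots,\alpha_{3N+1})$ and all entries of the first superdiagonal equal to $1$. When $\alpha_2\in[0,\mathcal K[N,1])$, each of the three bidiagonal factors is InTN.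
   Context: $T^{[N]}=(T_{i,j})_{0\le i,j\le N}$ is the real matrix with $T_{n,n+1}=1$, $T_{n,n}=c_n$, $T_{n,n-1}=b_n$, $T_{n,n-2}=a_n$, all other entries $0$, with $a_n>0$ for $2\le n\le N$. A finite matrix is TN if all its minors are nonnegative, InTN if it is TN and nonsingular, and oscillatory if it is TN and some power of it has all minors positive (equivalently, TN, irreducible and nonsingular). Let $\delta^{[n]}$ be the determinant of the leading principal submatrix of $T^{[N]}$ with rows and columns $0,\dots,n$, $\delta^{[-1]}=1$; for $T^{[N]}$ oscillatory these are positive. The Gauss--Borel factorization is $T^{[N]}=L^{[N]}U^{[N]}$ with $U^{[N]}$ upper bidiagonal with first superdiagonal of ones and diagonal $(\alpha_1,\alpha_4,\dots,\alpha_{3N+1})$, and $L^{[N]}$ lower unitriangular with $L_{n,n-1}=m_n$ ($1\le n\le N$), $L_{n,n-2}=l_n$ ($2\le n\le N$), other subdiagonal entries zero; explicitly $\alpha_{3n+1}=\delta^{[n]}/\delta^{[n-1]}$, $m_n=c_n-\alpha_{3n+1}$, $l_n=a_n/\alpha_{3n-5}$. The finite continued fraction is $$\mathcal K[N,1]=m_1-\cfrac{l_2}{m_2-\cfrac{l_3}{\ddots-\cfrac{l_N}{m_N}}},\qquad \mathcal K[1,1]=m_1.$$ *)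

theory Defs
  imports Complex_Main "Jordan_Normal_Form.Determinant" "Jordan_Normal_Form.DL_Submatrix"
begin

text \<open>All matrices are indexed from 0. Minors of every order occur here; the minor of order 0
  is 1 and imposes no condition.\<close>

definition totally_nonneg :: "real mat \<Rightarrow> bool" where
  "totally_nonneg A \<longleftrightarrow>
     (\<forall>I J. I \<subseteq> {..<dim_row A} \<and> J \<subseteq> {..<dim_col A} \<and> card I = card J \<longrightarrow>
        det (submatrix A I J) \<ge> 0)"

definition totally_pos :: "real mat \<Rightarrow> bool" where
  "totally_pos A \<longleftrightarrow>
     (\<forall>I J. I \<subseteq> {..<dim_row A} \<and> J \<subseteq> {..<dim_col A} \<and> card I = card J \<longrightarrow>
        det (submatrix A I J) > 0)"

definition InTN :: "real mat \<Rightarrow> bool" where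
  "InTN A \<longleftrightarrow> totally_nonneg A \<and> invertible_mat A"

definition oscillatory :: "real mat \<Rightarrow> bool" where
  "oscillatory A \<longleftrightarrow> totally_nonneg A \<and> (\<exists>k\<ge>1. totally_pos (A ^\<^sub>m k))"

definition T_mat :: "(nat \<Rightarrow> real) \<Rightarrow> (nat \<Rightarrow> real) \<Rightarrow> (nat \<Rightarrow> real) \<Rightarrow> nat \<Rightarrow> real mat" where
  "T_mat a b c N = mat (N + 1) (N + 1) (\<lambda>(i, j).
     if j = i + 1 then 1
     else if j = i then c i
     else if i = j + 1 then b i
     else if i = j + 2 then a i
     else 0)"

text \<open>The index is shifted by one so that it starts at 0: \<open>lead_minor a b c N k\<close> is the leading
  principal minor of order \<open>k\<close>, that is \<open>\<delta>\<^sup>[\<^sup>k\<^sup>-\<^sup>1\<^sup>]\<close>; for \<open>k = 0\<close> it is the determinant of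
  the empty matrix, which is 1.\<close>

definition lead_minor ::
  "(nat \<Rightarrow> real) \<Rightarrow> (nat \<Rightarrow> real) \<Rightarrow> (nat \<Rightarrow> real) \<Rightarrow> nat \<Rightarrow> nat \<Rightarrow> real" where
  "lead_minor a b c N k = det (submatrix (T_mat a b c N) {..<k} {..<k})"

text \<open>The factorization \<open>T = L U\<close>: \<open>pivot a b c N n\<close> is the diagonal entry \<open>\<alpha>\<^bsub>3n+1\<^esub>\<close> of \<open>U\<close>, and
  \<open>L_sub1\<close>, \<open>L_sub2\<close> are the entries \<open>m\<^sub>n\<close> (\<open>n \<ge> 1\<close>) and \<open>l\<^sub>n\<close> (\<open>n \<ge> 2\<close>) of \<open>L\<close>. Note that
  \<open>3n - 5 = 3(n - 2) + 1\<close>.\<close>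

definition pivot ::
  "(nat \<Rightarrow> real) \<Rightarrow> (nat \<Rightarrow> real) \<Rightarrow> (nat \<Rightarrow> real) \<Rightarrow> nat \<Rightarrow> nat \<Rightarrow> real" where
  "pivot a b c N n = lead_minor a b c N (n + 1) / lead_minor a b c N n"

definition L_sub1 ::
  "(nat \<Rightarrow> real) \<Rightarrow> (nat \<Rightarrow> real) \<Rightarrow> (nat \<Rightarrow> real) \<Rightarrow> nat \<Rightarrow> nat \<Rightarrow> real" where
  "L_sub1 a b c N n = c n - pivot a b c N n"

definition L_sub2 ::
  "(nat \<Rightarrow> real) \<Rightarrow> (nat \<Rightarrow> real) \<Rightarrow> (nat \<Rightarrow> real) \<Rightarrow> nat \<Rightarrow> nat \<Rightarrow> real" where
  "L_sub2 a b c N n = a n / pivot a b c N (n - 2)"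

text \<open>\<open>cont_frac m l d k = m\<^sub>k - l\<^bsub>k+1\<^esub> / (m\<^bsub>k+1\<^esub> - l\<^bsub>k+2\<^esub> / (\<dots> - l\<^bsub>k+d\<^esub> / m\<^bsub>k+d\<^esub>))\<close>\<close>

primrec cont_frac :: "(nat \<Rightarrow> real) \<Rightarrow> (nat \<Rightarrow> real) \<Rightarrow> nat \<Rightarrow> nat \<Rightarrow> real" where
  "cont_frac m l 0 k = m k"
| "cont_frac m l (Suc d) k = m k - l (k + 1) / cont_frac m l d (k + 1)"

text \<open>Meaningful for \<open>N \<ge> 1\<close> only.\<close>

definition K_frac ::
  "(nat \<Rightarrow> real) \<Rightarrow> (nat \<Rightarrow> real) \<Rightarrow> (nat \<Rightarrow> real) \<Rightarrow> nat \<Rightarrow> real" where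
  "K_frac a b c N = cont_frac (L_sub1 a b c N) (L_sub2 a b c N) (N - 1) 1"

text \<open>The subdiagonal entry in row \<open>n\<close> (\<open>1 \<le> n \<le> N\<close>) is \<open>s n\<close>.\<close>

definition lower_unibidiag :: "nat \<Rightarrow> (nat \<Rightarrow> real) \<Rightarrow> real mat" where
  "lower_unibidiag N s = mat (N + 1) (N + 1) (\<lambda>(i, j).
     if i = j then 1 else if i = j + 1 then s i else 0)"

definition upper_bidiag :: "nat \<Rightarrow> (nat \<Rightarrow> real) \<Rightarrow> real mat" where
  "upper_bidiag N d = mat (N + 1) (N + 1) (\<lambda>(i, j).
     if i = j then d i else if j = i + 1 then 1 else 0)"

text \<open>In all rows \<open>n\<close> where the subdiagonal is used, \<open>n \<ge> 1\<close>, so \<open>3 * n - 1\<close> does not truncate.\<close>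

definition L1_mat :: "nat \<Rightarrow> (nat \<Rightarrow> real) \<Rightarrow> real mat" where
  "L1_mat N \<alpha> = lower_unibidiag N (\<lambda>n. \<alpha> (3 * n - 1))"

definition L2_mat :: "nat \<Rightarrow> (nat \<Rightarrow> real) \<Rightarrow> real mat" where
  "L2_mat N \<alpha> = lower_unibidiag N (\<lambda>n. \<alpha> (3 * n))"

definition U_mat :: "nat \<Rightarrow> (nat \<Rightarrow> real) \<Rightarrow> real mat" where
  "U_mat N \<alpha> = upper_bidiag N (\<lambda>n. \<alpha> (3 * n + 1))"

text \<open>Only the values \<open>\<alpha> 1, \<dots>, \<alpha> (3 * N + 1)\<close> matter; positivity is not asked of \<open>\<alpha> 2 = x\<close>.\<close>

definition bidiag_factorization ::
  "(nat \<Rightarrow> real) \<Rightarrow> (nat \<Rightarrow> real) \<Rightarrow> (nat \<Rightarrow> real) \<Rightarrow> nat \<Rightarrow> real \<Rightarrow> (nat \<Rightarrow> real) \<Rightarrow> bool" where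
  "bidiag_factorization a b c N x \<alpha> \<longleftrightarrow>
     \<alpha> 2 = x \<and>
     (\<forall>i\<in>{1..3 * N + 1} - {2}. \<alpha> i > 0) \<and>
     T_mat a b c N = L1_mat N \<alpha> * L2_mat N \<alpha> * U_mat N \<alpha>"

end

theory Submission
  imports Defs
begin

text \<open>Comparing entries, \<open>L = L\<^sub>1 L\<^sub>2\<close> means \<open>\<alpha>\<^bsub>3n-1\<^esub> + \<alpha>\<^bsub>3n\<^esub> = m\<^sub>n\<close> and \<open>\<alpha>\<^bsub>3n+2\<^esub> \<alpha>\<^bsub>3n\<^esub> = l\<^bsub>n+1\<^esub>\<close>, so
  \<open>\<alpha>\<^sub>2\<close> determines everything. Let \<open>K\<^sub>n\<close> be the tail of the continued fraction starting at \<open>m\<^sub>n\<close>. If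
  \<open>\<alpha>\<^bsub>3n-1\<^esub> < K\<^sub>n = m\<^sub>n - l\<^bsub>n+1\<^esub> / K\<^bsub>n+1\<^esub>\<close> then \<open>\<alpha>\<^bsub>3n\<^esub> > l\<^bsub>n+1\<^esub> / K\<^bsub>n+1\<^esub>\<close>, hence
  \<open>0 < \<alpha>\<^bsub>3n+2\<^esub> < K\<^bsub>n+1\<^esub>\<close>; so positivity propagates once \<open>K\<^sub>n > 0\<close> for \<open>n \<ge> 2\<close>. Let \<open>w\<^sub>r \<ge> 0\<close> be the
  minor of \<open>T\<close> without row \<open>r\<close> and the last column. Up to signs these minors form a row of the
  adjugate of \<open>T = L U\<close>, which gives \<open>w\<^sub>j = m\<^bsub>j+1\<^esub> w\<^bsub>j+1\<^esub> - l\<^bsub>j+2\<^esub> w\<^bsub>j+2\<^esub>\<close>. As \<open>l\<^sub>n > 0\<close>, a zero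
  \<open>w\<^sub>j\<close> with \<open>j \<ge> 1\<close> would force \<open>w\<^sub>N = \<delta>\<^bsup>[N-1]\<^esup> = 0\<close>; hence \<open>K\<^sub>n = w\<^bsub>n-1\<^esub> / w\<^sub>n > 0\<close> for
  \<open>n \<ge> 2\<close>.\<close>

section \<open>Minors along strictly increasing index maps\<close>

text \<open>\<open>pick\<close> enumerates a set by rank, and the elements of the image below
  \<open>f i\<close> are exactly the \<open>i\<close> values of \<open>f\<close> on
  \<open>{..<i}\<close>.\<close>

lemma pick_strict_mono_image:
  assumes f: "strict_mono_on {..<k} f" and i: "i < k"
  shows "pick (f ` {..<k}) i = f i"
proof -
  have "{a \<in> f ` {..<k}. a < f i} = f ` {..<i}"
    using f i by (auto simp: strict_mono_on_less)
  moreover have "inj_on f {..<i}"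
    using strict_mono_on_imp_inj_on[OF f] i by (auto simp: inj_on_def)
  ultimately have "card {a \<in> f ` {..<k}. a < f i} = i"
    by (simp add: card_image)
  then show ?thesis
    using pick_card_in_set[of "f i" "f ` {..<k}"] i by simp
qed

lemma submatrix_strict_mono_image:
  assumes f: "strict_mono_on {..<k} f" "f ` {..<k} \<subseteq> {..<dim_row A}"
    and g: "strict_mono_on {..<l} g" "g ` {..<l} \<subseteq> {..<dim_col A}"
  shows "submatrix A (f ` {..<k}) (g ` {..<l}) = mat k l (\<lambda>(i, j). A $$ (f i, g j))"
proof -
  have "{i. i < dim_row A \<and> i \<in> f ` {..<k}} = f ` {..<k}"
    and "{j. j < dim_col A \<and> j \<in> g ` {..<l}} = g ` {..<l}"
    using f(2) g(2) by auto
  then have "card {i. i < dim_row A \<and> i \<in> f ` {..<k}} = k"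
    and "card {j. j < dim_col A \<and> j \<in> g ` {..<l}} = l"
    using f(1) g(1) by (simp_all add: card_image strict_mono_on_imp_inj_on)
  then show ?thesis
    unfolding submatrix_def
    by (intro eq_matI) (auto simp: pick_strict_mono_image[OF f(1)] pick_strict_mono_image[OF g(1)])
qed

lemma totally_nonneg_minor:
  assumes "totally_nonneg A"
    and f: "strict_mono_on {..<k} f" "f ` {..<k} \<subseteq> {..<dim_row A}"
    and g: "strict_mono_on {..<k} g" "g ` {..<k} \<subseteq> {..<dim_col A}"
  shows "det (mat k k (\<lambda>(i, j). A $$ (f i, g j))) \<ge> 0"
proof -
  have "card (f ` {..<k}) = card (g ` {..<k})"
    using f(1) g(1) by (simp add: card_image strict_mono_on_imp_inj_on)
  then have "det (submatrix A (f ` {..<k}) (g ` {..<k})) \<ge> 0"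
    using assms unfolding totally_nonneg_def by blast
  then show ?thesis
    by (simp add: submatrix_strict_mono_image[OF f g])
qed

text \<open>Each index set is enumerated increasingly by its own \<open>pick\<close>, so increasing
  maps reach every minor. Minors given by maps have explicit entries and can be treated by induction
  on the order.\<close>

lemma totally_nonnegI:
  assumes "\<And>k f g. strict_mono_on {..<k} f \<Longrightarrow> strict_mono_on {..<k} g \<Longrightarrow>
    f ` {..<k} \<subseteq> {..<dim_row A} \<Longrightarrow> g ` {..<k} \<subseteq> {..<dim_col A} \<Longrightarrow>
    det (mat k k (\<lambda>(i, j). A $$ (f i, g j))) \<ge> 0"
  shows "totally_nonneg A"
  unfolding totally_nonneg_def
proof (intro allI impI, elim conjE)
  fix I J assume I: "I \<subseteq> {..<dim_row A}" and J: "J \<subseteq> {..<dim_col A}" and c: "card I = card J"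
  have pick: "strict_mono_on {..<card S} (pick S)" "pick S ` {..<card S} \<subseteq> S" for S
    by (auto intro!: strict_mono_onI pick_mono pick_in_set)
  have "{i. i < dim_row A \<and> i \<in> I} = I" "{j. j < dim_col A \<and> j \<in> J} = J"
    using I J by auto
  then have "submatrix A I J = mat (card I) (card I) (\<lambda>(i, j). A $$ (pick I i, pick J j))"
    using c by (simp add: submatrix_def)
  then show "det (submatrix A I J) \<ge> 0"
    using assms[of "card I" "pick I" "pick J"] pick[of I] pick[of J] I J c by auto
qed

lemma mat_delete_mat:
  "mat_delete (mat (Suc m) (Suc n) f) r s =
     mat m n (\<lambda>(i, j). f (if i < r then i else Suc i, if j < s then j else Suc j))"
  unfolding mat_delete_def by (rule eq_matI) auto

lemma det_single_row:
  fixes A :: "'a :: comm_ring_1 mat"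
  assumes A: "A \<in> carrier_mat n n" and i: "i < n" "j < n"
    and z: "\<And>j'. j' < n \<Longrightarrow> j' \<noteq> j \<Longrightarrow> A $$ (i, j') = 0"
  shows "det A = A $$ (i, j) * cofactor A i j"
proof -
  have "det A = (\<Sum>j'<n. if j' = j then A $$ (i, j) * cofactor A i j else 0)"
    unfolding laplace_expansion_row[OF A i(1)] by (rule sum.cong) (auto simp: z)
  then show ?thesis using i by simp
qed

lemma det_single_col:
  fixes A :: "'a :: comm_ring_1 mat"
  assumes A: "A \<in> carrier_mat n n" and i: "i < n" "j < n"
    and z: "\<And>i'. i' < n \<Longrightarrow> i' \<noteq> i \<Longrightarrow> A $$ (i', j) = 0"
  shows "det A = A $$ (i, j) * cofactor A i j"
proof -
  have "det A = (\<Sum>i'<n. if i' = i then A $$ (i, j) * cofactor A i j else 0)"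
    unfolding laplace_expansion_column[OF A i(2)] by (rule sum.cong) (auto simp: z)
  then show ?thesis using i by simp
qed

section \<open>Bidiagonal matrices\<close>

text \<open>Induction on the order. If \<open>f 0 \<le> g 0\<close>, the later columns lie to the
  right of the diagonal in row \<open>f 0\<close>, so the first row vanishes after its first entry.
  Otherwise the later rows lie below the band in column \<open>g 0\<close>, so the first column
  does. Either way the minor is an entry times a smaller minor of the same kind.\<close>

lemma lower_bidiag_minor_nonneg:
  fixes F :: "nat \<Rightarrow> nat \<Rightarrow> real"
  assumes nonneg: "\<And>i j. F i j \<ge> 0" and band: "\<And>i j. \<not> (j \<le> i \<and> i \<le> Suc j) \<Longrightarrow> F i j = 0"
    and "strict_mono_on {..<k} f" "strict_mono_on {..<k} g"
  shows "det (mat k k (\<lambda>(i, j). F (f i) (g j))) \<ge> 0"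
  using assms(3,4)
proof (induction k arbitrary: f g)
  case 0
  then show ?case by simp
next
  case (Suc k)
  let ?A = "mat (Suc k) (Suc k) (\<lambda>(i, j). F (f i) (g j))"
  have f: "f 0 < f i" if "i < Suc k" "i \<noteq> 0" for i
    using strict_mono_onD[OF Suc.prems(1), of 0 i] that by simp
  have g: "g 0 < g i" if "i < Suc k" "i \<noteq> 0" for i
    using strict_mono_onD[OF Suc.prems(2), of 0 i] that by simp
  have "det (mat k k (\<lambda>(i, j). F ((f \<circ> Suc) i) ((g \<circ> Suc) j))) \<ge> 0"
    using Suc.prems by (intro Suc.IH) (auto simp: strict_mono_on_def)
  then have cof: "cofactor ?A 0 0 \<ge> 0"
    by (simp add: cofactor_def mat_delete_mat)
  have "det ?A = ?A $$ (0, 0) * cofactor ?A 0 0"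
  proof (cases "f 0 \<le> g 0")
    case True
    then show ?thesis
      by (intro det_single_row[of _ "Suc k"]) (auto intro!: band dest: g)
  next
    case False
    then show ?thesis
      by (intro det_single_col[of _ "Suc k"]) (auto intro!: band dest: f)
  qed
  then show ?case
    using cof nonneg by simp
qed

lemma det_nonzero_imp_invertible_mat:
  fixes A :: "'a :: field mat"
  assumes A: "A \<in> carrier_mat n n" and d: "det A \<noteq> 0"
  shows "invertible_mat A"
proof -
  let ?B = "inverse (det A) \<cdot>\<^sub>m adj_mat A"
  have c: "adj_mat A \<in> carrier_mat n n"
    using adj_mat(1)[OF A] .
  have "A * ?B = 1\<^sub>m n" "?B * A = 1\<^sub>m n"
    using d mult_smult_distrib[OF A c] mult_smult_assoc_mat[OF c A]
    by (auto simp: adj_mat[OF A] intro!: eq_matI)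
  then have "inverts_mat A ?B" "inverts_mat ?B A"
    using A c by (auto simp: inverts_mat_def)
  then show ?thesis
    using A unfolding invertible_mat_def by auto
qed

lemma InTN_lower_unibidiag:
  assumes s: "\<And>n. 1 \<le> n \<Longrightarrow> n \<le> N \<Longrightarrow> s n \<ge> 0"
  shows "InTN (lower_unibidiag N s)"
proof -
  let ?L = "lower_unibidiag N s"
  \<comment> \<open>The guard \<open>i \<le> N\<close> makes \<open>?F\<close> nonnegative
    everywhere, as the sign of \<open>s\<close> is known only up to \<open>N\<close>.\<close>
  let ?F = "\<lambda>i j. if i = j then 1 else if i = j + 1 \<and> i \<le> N then s i else 0"
  have "totally_nonneg ?L"
  proof (rule totally_nonnegI)
    fix k :: nat and f g :: "nat \<Rightarrow> nat"
    assume *: "strict_mono_on {..<k} f" "strict_mono_on {..<k} g"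
      "f ` {..<k} \<subseteq> {..<dim_row ?L}" "g ` {..<k} \<subseteq> {..<dim_col ?L}"
    then have le: "f i \<le> N" "g i \<le> N" if "i < k" for i
      using that by (auto simp: lower_unibidiag_def image_subset_iff less_Suc_eq_le)
    have "mat k k (\<lambda>(i, j). ?L $$ (f i, g j)) = mat k k (\<lambda>(i, j). ?F (f i) (g j))"
      by (intro eq_matI) (auto simp: lower_unibidiag_def le less_Suc_eq_le dest: le)
    moreover have "det (mat k k (\<lambda>(i, j). ?F (f i) (g j))) \<ge> 0"
      using s by (intro lower_bidiag_minor_nonneg *) auto
    ultimately show "det (mat k k (\<lambda>(i, j). ?L $$ (f i, g j))) \<ge> 0"
      by simp
  qed
  moreover have "det ?L = 1"
    by (subst det_lower_triangular[of "N + 1"])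
      (auto simp: lower_unibidiag_def prod_list_diag_prod)
  then have "invertible_mat ?L"
    by (intro det_nonzero_imp_invertible_mat[of _ "N + 1"]) (auto simp: lower_unibidiag_def)
  ultimately show ?thesis
    by (simp add: InTN_def)
qed

lemma InTN_upper_bidiag:
  assumes d: "\<And>n. n \<le> N \<Longrightarrow> d n > 0"
  shows "InTN (upper_bidiag N d)"
proof -
  let ?U = "upper_bidiag N d"
  \<comment> \<open>The entries of the transpose, which is lower bidiagonal; hence \<open>f\<close>
    and \<open>g\<close> exchange roles below.\<close>
  let ?F = "\<lambda>i j. if i = j \<and> i \<le> N then d i else if i = j + 1 then 1 else 0"
  have "totally_nonneg ?U"
  proof (rule totally_nonnegI)
    fix k :: nat and f g :: "nat \<Rightarrow> nat"
    assume *: "strict_mono_on {..<k} f" "strict_mono_on {..<k} g"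
      "f ` {..<k} \<subseteq> {..<dim_row ?U}" "g ` {..<k} \<subseteq> {..<dim_col ?U}"
    then have le: "f i \<le> N" "g i \<le> N" if "i < k" for i
      using that by (auto simp: upper_bidiag_def image_subset_iff less_Suc_eq_le)
    have "mat k k (\<lambda>(i, j). ?U $$ (f i, g j)) =
        transpose_mat (mat k k (\<lambda>(i, j). ?F (g i) (f j)))"
      by (intro eq_matI) (auto simp: upper_bidiag_def le less_Suc_eq_le dest: le)
    then have "det (mat k k (\<lambda>(i, j). ?U $$ (f i, g j))) =
        det (mat k k (\<lambda>(i, j). ?F (g i) (f j)))"
      by (simp add: det_transpose[of _ k])
    moreover have "det (mat k k (\<lambda>(i, j). ?F (g i) (f j))) \<ge> 0"
      using d by (intro lower_bidiag_minor_nonneg *) (auto intro: less_imp_le)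
    ultimately show "det (mat k k (\<lambda>(i, j). ?U $$ (f i, g j))) \<ge> 0"
      by simp
  qed
  moreover have "det ?U = (\<Prod>i<N + 1. d i)"
    by (subst det_upper_triangular[of _ "N + 1"])
      (auto simp: upper_bidiag_def prod_list_diag_prod upper_triangular_def atLeast0LessThan)
  then have "invertible_mat ?U"
    using d by (intro det_nonzero_imp_invertible_mat[of _ "N + 1"])
      (auto simp: upper_bidiag_def less_Suc_eq_le less_imp_neq[symmetric])
  ultimately show ?thesis
    by (simp add: InTN_def)
qed

section \<open>Entries of the product of three bidiagonal factors\<close>

lemma lower_unibidiag_mult_index:
  assumes "B \<in> carrier_mat (N + 1) n" "i \<le> N" "j < n"
  shows "(lower_unibidiag N s * B) $$ (i, j) =
    B $$ (i, j) + (if i = 0 then 0 else s i * B $$ (i - 1, j))"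
proof -
  have "(lower_unibidiag N s * B) $$ (i, j) = (\<Sum>k<N + 1. lower_unibidiag N s $$ (i, k) * B $$ (k, j))"
    using assms by (simp add: lower_unibidiag_def scalar_prod_def atLeast0LessThan)
  also have "\<dots> = (\<Sum>k<N + 1. (if k = i then B $$ (i, j) else 0) +
      (if k = i - 1 then (if i = 0 then 0 else s i * B $$ (i - 1, j)) else 0))"
    using assms by (intro sum.cong) (auto simp: lower_unibidiag_def)
  also have "\<dots> = B $$ (i, j) + (if i = 0 then 0 else s i * B $$ (i - 1, j))"
    using assms by (subst sum.distrib) auto
  finally show ?thesis .
qed

text \<open>The product automatically has superdiagonal 1 and zeros outside the band, so only the
  diagonal and two subdiagonals give conditions. Row 1 is special because no row lies two above
  it.\<close>

lemma bidiag_product_eq_T_mat_iff: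
  "T_mat a b c N = lower_unibidiag N s * lower_unibidiag N t * upper_bidiag N d \<longleftrightarrow>
     c 0 = d 0 \<and>
     (\<forall>n\<in>{1..N}. c n = s n + t n + d n \<and>
        b n = (s n + t n) * d (n - 1) + (if n = 1 then 0 else s n * t (n - 1))) \<and>
     (\<forall>n\<in>{2..N}. a n = s n * t (n - 1) * d (n - 2))"
  (is "?T = ?P \<longleftrightarrow> ?R")
proof -
  let ?L = "lower_unibidiag N s" and ?L' = "lower_unibidiag N t" and ?U = "upper_bidiag N d"
  have carr: "?L \<in> carrier_mat (N + 1) (N + 1)" "?L' \<in> carrier_mat (N + 1) (N + 1)"
    "?U \<in> carrier_mat (N + 1) (N + 1)"
    by (auto simp: lower_unibidiag_def upper_bidiag_def)
  have carr_mult: "?L' * ?U \<in> carrier_mat (N + 1) (N + 1)"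
    using carr by simp
  have P: "?P = ?L * (?L' * ?U)"
    using carr by (rule assoc_mult_mat)
  \<comment> \<open>Each lower factor adds a multiple of the preceding row; two of them combine rows
    \<open>i\<close>, \<open>i - 1\<close> and \<open>i - 2\<close> of \<open>?U\<close>.\<close>
  have entry: "?P $$ (i, j) = ?U $$ (i, j) + (if i = 0 then 0 else (s i + t i) * ?U $$ (i - 1, j)) +
      (if i \<le> 1 then 0 else s i * t (i - 1) * ?U $$ (i - 2, j))" if "i \<le> N" "j \<le> N" for i j
    using that unfolding P
    by (subst lower_unibidiag_mult_index[OF carr_mult])
      (auto simp: lower_unibidiag_mult_index[OF carr(3)] algebra_simps numeral_2_eq_2)
  have U: "?U $$ (i, j) = (if i = j then d i else if j = i + 1 then 1 else 0)"
    if "i \<le> N" "j \<le> N" for i j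
    using that by (simp add: upper_bidiag_def)
  have T: "?T $$ (i, j) = (if j = i + 1 then 1 else if j = i then c i
      else if i = j + 1 then b i else if i = j + 2 then a i else 0)"
    if "i \<le> N" "j \<le> N" for i j
    using that by (simp add: T_mat_def)
  show ?thesis
  proof
    assume eq: "?T = ?P"
    have E: "?T $$ (i, j) = ?U $$ (i, j) + (if i = 0 then 0 else (s i + t i) * ?U $$ (i - 1, j)) +
      (if i \<le> 1 then 0 else s i * t (i - 1) * ?U $$ (i - 2, j))" if "i \<le> N" "j \<le> N" for i j
      using entry[OF that] eq by simp
    have "c 0 = d 0"
      using E[of 0 0] by (simp add: T U)
    moreover have "c n = s n + t n + d n" if "n \<in> {1..N}" for n
      using E[of n n] that by (auto simp: T U split: if_splits)
    moreover have "b n = (s n + t n) * d (n - 1) + (if n = 1 then 0 else s n * t (n - 1))"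
      if "n \<in> {1..N}" for n
    proof -
      from that consider "n = 1" | k where "n = Suc (Suc k)"
        by (metis One_nat_def atLeastAtMost_iff not0_implies_Suc not_one_le_zero)
      then show ?thesis
        using E[of n "n - 1"] that by cases (auto simp: T U)
    qed
    moreover have "a n = s n * t (n - 1) * d (n - 2)" if "n \<in> {2..N}" for n
    proof -
      from that obtain k where "n = Suc (Suc k)"
        by (metis atLeastAtMost_iff less_eqE add_2_eq_Suc)
      then show ?thesis
        using E[of n "n - 2"] that by (auto simp: T U)
    qed
    ultimately show ?R by blast
  next
    assume R: ?R
    show "?T = ?P"
    proof (rule eq_matI)
      fix i j assume "i < dim_row ?P" "j < dim_col ?P"
      then have ij: "i \<le> N" "j \<le> N"
        by (auto simp: lower_unibidiag_def upper_bidiag_def)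
      consider "i < j" | "i = j" | "i = Suc j" | "i = Suc (Suc j)" | "Suc (Suc j) < i"
        by linarith
      then show "?T $$ (i, j) = ?P $$ (i, j)"
        using ij R unfolding entry[OF ij] by cases (auto simp: T U)
    qed (auto simp: T_mat_def lower_unibidiag_def upper_bidiag_def)
  qed
qed

section \<open>Leading principal minors\<close>

text \<open>The bottom row \<open>r\<close> is left free because expanding along the last column
  deletes row \<open>k\<close> and keeps row \<open>r\<close> at the bottom, which closes the
  recursion.\<close>

definition border_minor :: "(nat \<Rightarrow> nat \<Rightarrow> 'a :: comm_ring_1) \<Rightarrow> nat \<Rightarrow> nat \<Rightarrow> 'a" where
  "border_minor F k r = det (mat (Suc k) (Suc k) (\<lambda>(i, j). F (if i = k then r else i) j))"

lemma border_minor_0 [simp]: "border_minor F 0 r = F r 0"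
  by (simp add: border_minor_def det_single laplace_expansion_row[of _ 1 0] cofactor_def)

text \<open>In the last column only the 1 in row \<open>k\<close> and the bottom entry can be
  nonzero; the former carries the sign -1.\<close>

lemma border_minor_Suc:
  assumes "F k (Suc k) = 1" and "\<And>i. i < k \<Longrightarrow> F i (Suc k) = 0"
  shows "border_minor F (Suc k) r = F r (Suc k) * border_minor F k k - border_minor F k r"
proof -
  let ?A = "mat (Suc (Suc k)) (Suc (Suc k)) (\<lambda>(i, j). F (if i = Suc k then r else i) j)"
  have "mat_delete ?A (Suc k) (Suc k) = mat (Suc k) (Suc k) (\<lambda>(i, j). F (if i = k then k else i) j)"
    by (subst mat_delete_mat, rule eq_matI) auto
  then have 1: "cofactor ?A (Suc k) (Suc k) = border_minor F k k"
    by (simp add: cofactor_def border_minor_def)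
  have "mat_delete ?A k (Suc k) = mat (Suc k) (Suc k) (\<lambda>(i, j). F (if i = k then r else i) j)"
    by (subst mat_delete_mat, rule eq_matI) auto
  then have 2: "cofactor ?A k (Suc k) = - border_minor F k r"
    by (simp add: cofactor_def border_minor_def)
  have "det ?A = (\<Sum>i<Suc (Suc k). ?A $$ (i, Suc k) * cofactor ?A i (Suc k))"
    by (rule laplace_expansion_column) auto
  also have "\<dots> = (\<Sum>i<k. ?A $$ (i, Suc k) * cofactor ?A i (Suc k)) +
      ?A $$ (k, Suc k) * cofactor ?A k (Suc k) + ?A $$ (Suc k, Suc k) * cofactor ?A (Suc k) (Suc k)"
    by (simp only: sum.lessThan_Suc)
  also have "(\<Sum>i<k. ?A $$ (i, Suc k) * cofactor ?A i (Suc k)) = 0"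
    by (rule sum.neutral) (use assms(2) in auto)
  finally show ?thesis
    unfolding 1 2 using assms(1) by (simp add: border_minor_def)
qed

text \<open>Without the size cut-off of \<open>T_mat\<close>, the determinant recursions need no
  index bounds and do not depend on \<open>N\<close>.\<close>

definition tetra :: "(nat \<Rightarrow> real) \<Rightarrow> (nat \<Rightarrow> real) \<Rightarrow> (nat \<Rightarrow> real) \<Rightarrow> nat \<Rightarrow> nat \<Rightarrow> real" where
  "tetra a b c i j = (if j = i + 1 then 1 else if j = i then c i
     else if i = j + 1 then b i else if i = j + 2 then a i else 0)"

lemma T_mat_eq_tetra: "T_mat a b c N = mat (N + 1) (N + 1) (\<lambda>(i, j). tetra a b c i j)"
  by (simp add: T_mat_def tetra_def)

lemma T_mat_carrier: "T_mat a b c N \<in> carrier_mat (N + 1) (N + 1)"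
  by (simp add: T_mat_def)

lemma border_minor_tetra_Suc:
  "border_minor (tetra a b c) (Suc k) r =
     tetra a b c r (Suc k) * border_minor (tetra a b c) k k - border_minor (tetra a b c) k r"
  by (rule border_minor_Suc) (auto simp: tetra_def)

text \<open>Row \<open>r\<close> can be nonzero only from column \<open>r - 2\<close> on, past the
  columns \<open>0\<close> to \<open>k\<close> in use.\<close>

lemma border_minor_tetra_eq_0: "k + 2 < r \<Longrightarrow> border_minor (tetra a b c) k r = 0"
  by (induction k) (simp_all add: border_minor_tetra_Suc, simp_all add: tetra_def)

lemma lead_minor_eq_det:
  assumes "k \<le> N + 1"
  shows "lead_minor a b c N k = det (mat k k (\<lambda>(i, j). tetra a b c i j))"
proof -
  have "submatrix (T_mat a b c N) ((\<lambda>i. i) ` {..<k}) ((\<lambda>i. i) ` {..<k}) =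
      mat k k (\<lambda>(i, j). T_mat a b c N $$ (i, j))"
    using assms by (intro submatrix_strict_mono_image) (auto simp: T_mat_def strict_mono_on_def)
  also have "\<dots> = mat k k (\<lambda>(i, j). tetra a b c i j)"
    using assms by (intro eq_matI) (auto simp: T_mat_eq_tetra)
  finally show ?thesis
    by (simp add: lead_minor_def)
qed

lemma lead_minor_0 [simp]: "lead_minor a b c N 0 = 1"
  by (simp add: lead_minor_eq_det)

lemma lead_minor_Suc:
  assumes "k \<le> N"
  shows "lead_minor a b c N (Suc k) = border_minor (tetra a b c) k k"
proof -
  have "mat (Suc k) (Suc k) (\<lambda>(i, j). tetra a b c i j) =
      mat (Suc k) (Suc k) (\<lambda>(i, j). tetra a b c (if i = k then k else i) j)"
    by (rule eq_matI) auto
  with assms show ?thesis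
    by (simp add: lead_minor_eq_det border_minor_def)
qed

lemma det_T_mat: "det (T_mat a b c N) = lead_minor a b c N (Suc N)"
  by (simp add: lead_minor_eq_det T_mat_eq_tetra)

lemma lead_minor_1: "lead_minor a b c N (Suc 0) = c 0"
  by (simp add: lead_minor_Suc tetra_def)

lemma lead_minor_rec:
  assumes "1 \<le> n" "n \<le> N"
  shows "lead_minor a b c N (Suc n) =
    c n * lead_minor a b c N n - border_minor (tetra a b c) (n - 1) n"
  using assms by (cases n) (simp_all add: lead_minor_Suc border_minor_tetra_Suc, simp add: tetra_def)

text \<open>Two more expansion steps pick up \<open>b n\<close> and \<open>a n\<close>; the border
  minor that then remains is zero. With \<open>lead_minor_rec\<close> this is the recurrence
  \<open>D (n + 1) = c n * D n - b n * D (n - 1) + a n * D (n - 2)\<close> of the leading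
  minors.\<close>

lemma border_minor_subdiag:
  assumes "1 \<le> n" "n \<le> N"
  shows "border_minor (tetra a b c) (n - 1) n =
    b n * lead_minor a b c N (n - 1) - (if n = 1 then 0 else a n * lead_minor a b c N (n - 2))"
proof -
  consider "n = 1" | "n = 2" | k where "n = Suc (Suc (Suc k))"
    using assms(1) by (metis One_nat_def not0_implies_Suc not_one_le_zero numeral_2_eq_2)
  then show ?thesis
  proof cases
    case 3
    then show ?thesis
      using assms
      by (simp add: lead_minor_Suc border_minor_tetra_Suc border_minor_tetra_eq_0)
        (simp add: tetra_def)
  qed (use assms in \<open>simp_all add: numeral_2_eq_2 lead_minor_1 border_minor_tetra_Suc, simp_all add: tetra_def\<close>)
qed

lemma lead_minor_nonneg:
  assumes "totally_nonneg (T_mat a b c N)" "k \<le> N + 1"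
  shows "lead_minor a b c N k \<ge> 0"
  using assms unfolding lead_minor_def totally_nonneg_def by (simp add: T_mat_def)

text \<open>Putting row \<open>k + 1\<close> in place of row \<open>k\<close> keeps the rows
  increasing, so this is a genuine minor of the matrix.\<close>

lemma border_minor_nonneg:
  assumes TN: "totally_nonneg (T_mat a b c N)" and k: "Suc k \<le> N"
  shows "border_minor (tetra a b c) k (Suc k) \<ge> 0"
proof -
  let ?f = "\<lambda>i. if i = k then Suc k else i"
  have "det (mat (Suc k) (Suc k) (\<lambda>(i, j). T_mat a b c N $$ (?f i, id j))) \<ge> 0"
    using k by (intro totally_nonneg_minor[OF TN]) (auto simp: T_mat_def strict_mono_on_def)
  also have "mat (Suc k) (Suc k) (\<lambda>(i, j). T_mat a b c N $$ (?f i, id j)) =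
      mat (Suc k) (Suc k) (\<lambda>(i, j). tetra a b c (?f i) j)"
    using k by (intro eq_matI) (auto simp: T_mat_eq_tetra)
  finally show ?thesis
    by (simp add: border_minor_def)
qed

text \<open>Expanding along the last column gives \<open>\<delta>\<^bsup>[k]\<^esup> \<le> c\<^sub>k \<delta>\<^bsup>[k-1]\<^esup>\<close>, so a vanishing leading minor
  makes all later ones vanish, including the determinant.\<close>

lemma lead_minor_pos:
  assumes TN: "totally_nonneg (T_mat a b c N)" and det: "det (T_mat a b c N) \<noteq> 0"
    and k: "k \<le> N + 1"
  shows "lead_minor a b c N k > 0"
proof (rule ccontr)
  assume "\<not> lead_minor a b c N k > 0"
  then have k0: "lead_minor a b c N k = 0"
    using lead_minor_nonneg[OF TN k] by simp
  then have "k \<noteq> 0"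
    by (metis lead_minor_0 zero_neq_one)
  have "lead_minor a b c N n = 0" if "n \<ge> k" "n \<le> N + 1" for n
    using that
  proof (induction n rule: dec_induct)
    case base
    then show ?case by (simp add: k0)
  next
    case (step n)
    then have n: "1 \<le> n" "n \<le> N"
      using \<open>k \<noteq> 0\<close> by auto
    have "border_minor (tetra a b c) (n - 1) n \<ge> 0"
      using border_minor_nonneg[OF TN, of "n - 1"] n by simp
    then have "lead_minor a b c N (Suc n) \<le> 0"
      using lead_minor_rec[OF n, of a b c] step by simp
    then show ?case
      using lead_minor_nonneg[OF TN, of "Suc n"] n by simp
  qed
  then show False
    using det k unfolding det_T_mat by simp
qed

text \<open>The full determinant of a totally positive power is one of its positive minors, and it
  has \<open>det A\<close> as a factor.\<close>

lemma oscillatory_det_nonzero: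
  assumes osc: "oscillatory A" and A: "A \<in> carrier_mat n n"
  shows "det A \<noteq> 0"
proof
  assume 0: "det A = 0"
  obtain k where k: "k \<ge> 1" "totally_pos (A ^\<^sub>m k)"
    using osc unfolding oscillatory_def by blast
  have P: "A ^\<^sub>m k \<in> carrier_mat n n"
    using A by (rule pow_carrier_mat)
  have "submatrix (A ^\<^sub>m k) ((\<lambda>i. i) ` {..<n}) ((\<lambda>i. i) ` {..<n}) =
      mat n n (\<lambda>(i, j). (A ^\<^sub>m k) $$ (i, j))"
    using P by (intro submatrix_strict_mono_image) (auto simp: strict_mono_on_def)
  also have "\<dots> = A ^\<^sub>m k"
    by (intro eq_matI) (auto simp: carrier_matD[OF P] simp del: pow_mat_dim)
  finally have "det (A ^\<^sub>m k) > 0"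
    using k(2) P unfolding totally_pos_def
    by (metis carrier_matD image_ident order_refl)
  moreover obtain k' where "k = Suc k'"
    using k(1) by (cases k) auto
  then have "det (A ^\<^sub>m k) = 0"
    using 0 A det_mult[OF pow_carrier_mat[OF A] A, of k'] by simp
  ultimately show False by simp
qed

section \<open>Positivity of the continued fraction\<close>

lemma sum_tetra_column:
  assumes j: "j < N" and w: "w (Suc N) = (0 :: real)"
  shows "(\<Sum>r<Suc N. (- 1) ^ r * w r * tetra a b c r j) =
    (- 1) ^ j * (c j * w j - (if j = 0 then 0 else w (j - 1)) - b (j + 1) * w (j + 1) +
      a (j + 2) * w (j + 2))"
proof -
  \<comment> \<open>For \<open>j = N - 1\<close> the index \<open>j + 2\<close> is
    \<open>N + 1\<close>; since \<open>w\<close> vanishes there, the sum may be extended to include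
    it.\<close>
  have "(\<Sum>r<Suc N. (- 1) ^ r * w r * tetra a b c r j) =
    (\<Sum>r<Suc (Suc N). (- 1) ^ r * w r * tetra a b c r j)"
    using w by simp
  \<comment> \<open>For \<open>j = 0\<close> truncated subtraction makes \<open>j - 1\<close>
    collide with \<open>j\<close>; the inner conditional removes that term.\<close>
  also have "\<dots> = (\<Sum>r<Suc (Suc N). (if r = j - 1 then if j = 0 then 0 else - ((- 1) ^ j * w (j - 1)) else 0) +
      (if r = j then (- 1) ^ j * w j * c j else 0) +
      (if r = j + 1 then - ((- 1) ^ j * w (j + 1) * b (j + 1)) else 0) +
      (if r = j + 2 then (- 1) ^ j * w (j + 2) * a (j + 2) else 0))"
    by (rule sum.cong) (auto simp: tetra_def)
  also have "\<dots> = (- 1) ^ j * (c j * w j - (if j = 0 then 0 else w (j - 1)) - b (j + 1) * w (j + 1) + a (j + 2) * w (j + 2))"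
    unfolding sum.distrib using j by (auto simp: algebra_simps)
  finally show ?thesis .
qed

text \<open>The value 0 beyond \<open>N\<close> is the boundary condition that lets the recursions
  below reach their last step without a separate case.\<close>

definition last_col_minor ::
  "(nat \<Rightarrow> real) \<Rightarrow> (nat \<Rightarrow> real) \<Rightarrow> (nat \<Rightarrow> real) \<Rightarrow> nat \<Rightarrow> nat \<Rightarrow> real" where
  "last_col_minor a b c N r = (if r \<le> N then det (mat_delete (T_mat a b c N) r N) else 0)"

lemma last_col_minor_N: "last_col_minor a b c N N = lead_minor a b c N N"
proof -
  have "mat_delete (T_mat a b c N) N N = mat N N (\<lambda>(i, j). tetra a b c i j)"
    unfolding T_mat_eq_tetra using mat_delete_mat[of N N "\<lambda>(i, j). tetra a b c i j" N N]
    by (intro eq_matI) auto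
  then show ?thesis
    by (simp add: last_col_minor_def lead_minor_eq_det)
qed

lemma last_col_minor_nonneg:
  assumes TN: "totally_nonneg (T_mat a b c N)"
  shows "last_col_minor a b c N r \<ge> 0"
proof -
  let ?f = "\<lambda>i. if i < r then i else Suc i"
  have "det (mat N N (\<lambda>(i, j). T_mat a b c N $$ (?f i, id j))) \<ge> 0"
    by (intro totally_nonneg_minor[OF TN]) (auto simp: T_mat_def strict_mono_on_def)
  also have "mat N N (\<lambda>(i, j). T_mat a b c N $$ (?f i, id j)) = mat_delete (T_mat a b c N) r N"
    by (rule eq_matI) (auto simp: mat_delete_def T_mat_def)
  finally show ?thesis
    by (simp add: last_col_minor_def)
qed

text \<open>The signed minors form the last row of the adjugate, hence are orthogonal to all columns of
  the matrix but the last.\<close>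

lemma last_col_minor_tetra:
  fixes a b c :: "nat \<Rightarrow> real"
  assumes j: "j < N"
  defines "w \<equiv> last_col_minor a b c N"
  shows "c j * w j + a (j + 2) * w (j + 2) = (if j = 0 then 0 else w (j - 1)) + b (j + 1) * w (j + 1)"
proof -
  let ?T = "T_mat a b c N"
  have T: "?T \<in> carrier_mat (Suc N) (Suc N)"
    by (simp add: T_mat_def)
  have "0 = (adj_mat ?T * ?T) $$ (N, j)"
    using j by (simp add: adj_mat(3)[OF T])
  also have "\<dots> = (\<Sum>r<Suc N. cofactor ?T r N * tetra a b c r j)"
    using j by (simp add: adj_mat_def scalar_prod_def T_mat_eq_tetra atLeast0LessThan)
  also have "\<dots> = (\<Sum>r<Suc N. (- 1) ^ N * ((- 1) ^ r * w r * tetra a b c r j))"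
    by (rule sum.cong) (simp_all add: cofactor_def w_def last_col_minor_def power_add)
  also have "\<dots> = (- 1) ^ N * (\<Sum>r<Suc N. (- 1) ^ r * w r * tetra a b c r j)"
    by (simp only: sum_distrib_left)
  finally have "(\<Sum>r<Suc N. (- 1) ^ r * w r * tetra a b c r j) = 0"
    by simp
  then show ?thesis
    using sum_tetra_column[OF j, of w a b c] by (simp add: w_def last_col_minor_def)
qed

section \<open>The relations of \<open>T = L U\<close> and the recursion they give for the
  minors\<close>

lemma pivot_pos:
  assumes "\<And>k. k \<le> N + 1 \<Longrightarrow> lead_minor a b c N k > 0" "n \<le> N"
  shows "pivot a b c N n > 0"
  using assms by (simp add: pivot_def)

lemma L_sub1_0: "L_sub1 a b c N 0 = 0"
  by (simp add: L_sub1_def pivot_def lead_minor_1)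

lemma diag_eq_L_sub1: "c n = L_sub1 a b c N n + pivot a b c N n"
  by (simp add: L_sub1_def)

text \<open>This is the first subdiagonal of \<open>T = L U\<close>. By
  \<open>lead_minor_rec\<close> the product of \<open>L_sub1\<close> and \<open>?D n\<close> is a
  border minor; expanding it and dividing by \<open>?D (n - 1)\<close> gives the claim.\<close>

lemma sub1_eq_L_sub:
  assumes pos: "\<And>k. k \<le> N + 1 \<Longrightarrow> lead_minor a b c N k > 0" and n: "1 \<le> n" "n \<le> N"
  shows "b n = L_sub1 a b c N n * pivot a b c N (n - 1) + (if n = 1 then 0 else L_sub2 a b c N n)"
proof -
  let ?D = "lead_minor a b c N"
  have "pivot a b c N n * ?D n = ?D (Suc n)"
    using pos[of n] n by (simp add: pivot_def)
  then have "L_sub1 a b c N n * ?D n = border_minor (tetra a b c) (n - 1) n"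
    using lead_minor_rec[OF n, of a b c] by (simp add: L_sub1_def left_diff_distrib)
  also have "\<dots> = b n * ?D (n - 1) - (if n = 1 then 0 else a n * ?D (n - 2))"
    by (rule border_minor_subdiag[OF n])
  finally have *: "b n * ?D (n - 1) = L_sub1 a b c N n * ?D n + (if n = 1 then 0 else a n * ?D (n - 2))"
    by simp
  have "?D (n - 1) > 0" "?D (n - 2) > 0"
    using n by (auto intro!: pos)
  then have nz: "?D (n - 1) \<noteq> 0" "?D (n - 2) \<noteq> 0" "Suc (n - 1) = n"
    using n by auto
  have "Suc (n - 2) = n - 1" if "n \<noteq> 1"
    using n that by simp
  then show ?thesis
    using * nz by (auto simp: pivot_def L_sub2_def field_simps)
qed

lemma sub2_eq_L_sub2:
  assumes "\<And>k. k \<le> N + 1 \<Longrightarrow> lead_minor a b c N k > 0" "2 \<le> n" "n \<le> N"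
  shows "a n = L_sub2 a b c N n * pivot a b c N (n - 2)"
proof -
  have "pivot a b c N (n - 2) > 0"
    using assms(3) by (intro pivot_pos[OF assms(1)]) auto
  then show ?thesis
    by (simp add: L_sub2_def)
qed

text \<open>Let \<open>e j\<close> be the difference of the two sides. Inserting
  \<open>T = L U\<close> into the orthogonality to column \<open>j\<close> gives
  \<open>p j * e j = e (j - 1)\<close> with pivots \<open>p j\<close>, and
  \<open>p 0 * e 0 = 0\<close> since \<open>L_sub1\<close> is 0 at index 0. The pivots are positive,
  so all differences vanish in turn.\<close>

lemma last_col_minor_rec:
  fixes a b c :: "nat \<Rightarrow> real"
  assumes pos: "\<And>k. k \<le> N + 1 \<Longrightarrow> lead_minor a b c N k > 0" and "j < N"
  defines "w \<equiv> last_col_minor a b c N"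
  shows "w j = L_sub1 a b c N (j + 1) * w (j + 1) - L_sub2 a b c N (j + 2) * w (j + 2)"
  using \<open>j < N\<close>
proof (induction j)
  let ?m = "L_sub1 a b c N" and ?l = "L_sub2 a b c N" and ?p = "pivot a b c N"
  have eq: "(?m j + ?p j) * w j + ?l (j + 2) * ?p j * w (j + 2) =
      (if j = 0 then 0 else w (j - 1)) + (?m (j + 1) * ?p j + (if j = 0 then 0 else ?l (j + 1))) * w (j + 1)"
    if "j < N" for j
  proof -
    \<comment> \<open>If \<open>j + 2 > N\<close>, both sides are zero because
      \<open>w (j + 2) = 0\<close>.\<close>
    have a: "a (j + 2) * w (j + 2) = ?l (j + 2) * ?p j * w (j + 2)"
      using sub2_eq_L_sub2[of N a b c "j + 2"] pos
      by (cases "j + 2 \<le> N") (auto simp: w_def last_col_minor_def)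
    have b: "b (j + 1) = ?m (j + 1) * ?p j + (if j = 0 then 0 else ?l (j + 1))"
      using sub1_eq_L_sub[of N a b c "j + 1"] pos that by simp
    show ?thesis
      using last_col_minor_tetra[OF that, of c a b, folded w_def]
      unfolding a b diag_eq_L_sub1[of c j a b N] .
  qed
  {
    case 0
    then have "?p 0 * (w 0 - (?m 1 * w 1 - ?l 2 * w 2)) = 0"
      using eq[of 0] by (simp add: L_sub1_0 algebra_simps numeral_2_eq_2)
    then show ?case
      using pivot_pos[OF pos, of 0] by (simp add: numeral_2_eq_2)
  next
    case (Suc j)
    then have "w j = ?m (j + 1) * w (j + 1) - ?l (j + 2) * w (j + 2)"
      by simp
    then have "?p (Suc j) * (w (Suc j) - (?m (Suc j + 1) * w (Suc j + 1) - ?l (Suc j + 2) * w (Suc j + 2))) = 0"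
      using eq[OF Suc.prems] by (simp add: algebra_simps)
    then show ?case
      using pivot_pos[OF pos, of "Suc j"] Suc.prems by simp
  }
qed

text \<open>If \<open>w i = 0\<close> with \<open>i \<ge> 1\<close>, the recursion reads
  \<open>w (i - 1) = - l (i + 1) * w (i + 1)\<close>, and the signs force
  \<open>w (i + 1) = 0\<close>. A zero would thus travel up to \<open>N\<close>.\<close>

lemma three_term_rec_pos:
  fixes w m l :: "nat \<Rightarrow> real"
  assumes rec: "\<And>j. j < N \<Longrightarrow> w j = m (j + 1) * w (j + 1) - l (j + 2) * w (j + 2)"
    and nonneg: "\<And>j. w j \<ge> 0" and wN: "w N > 0"
    and l: "\<And>n. 2 \<le> n \<Longrightarrow> n \<le> N \<Longrightarrow> l n > 0"
    and j: "1 \<le> j" "j \<le> N"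
  shows "w j > 0"
proof (rule ccontr)
  assume "\<not> w j > 0"
  then have j0: "w j = 0"
    using nonneg[of j] by simp
  have "w i = 0" if "i \<ge> j" "i \<le> N" for i
    using that
  proof (induction i rule: dec_induct)
    case base
    then show ?case by (simp add: j0)
  next
    case (step i)
    then have "w (i - 1) = - (l (i + 1) * w (i + 1))"
      using rec[of "i - 1"] j by (simp add: Suc_diff_le)
    then have "l (i + 1) * w (i + 1) \<le> 0"
      using nonneg[of "i - 1"] by simp
    then show ?case
      using l[of "i + 1"] nonneg[of "i + 1"] step j by (simp add: mult_le_0_iff)
  qed
  then show False
    using wN j by simp
qed

text \<open>Dividing the recursion by \<open>w k\<close> expresses \<open>w (k - 1) / w k\<close>
  through \<open>w k / w (k + 1)\<close> just as the fraction unfolds. The innermost level is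
  \<open>m N\<close> because \<open>w (N + 1) = 0\<close>.\<close>

lemma cont_frac_eq_quotient:
  fixes w m l :: "nat \<Rightarrow> real"
  assumes rec: "\<And>j. j < N \<Longrightarrow> w j = m (j + 1) * w (j + 1) - l (j + 2) * w (j + 2)"
    and w: "w (N + 1) = 0" and pos: "\<And>j. 1 \<le> j \<Longrightarrow> j \<le> N \<Longrightarrow> w j > 0"
    and "d + k = N" "1 \<le> k"
  shows "cont_frac m l d k = w (k - 1) / w k"
  using assms(4,5)
proof (induction d arbitrary: k)
  case 0
  then show ?case
    using rec[of "N - 1"] w pos[of N] by (simp add: Suc_diff_le)
next
  case (Suc d)
  then have "cont_frac m l d (k + 1) = w k / w (k + 1)"
    by simp
  moreover have "w (k - 1) = m k * w k - l (k + 1) * w (k + 1)" "w k > 0"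
    using rec[of "k - 1"] pos[of k] Suc.prems by simp_all
  ultimately show ?case
    by (simp add: diff_divide_distrib)
qed

text \<open>The fraction equals \<open>w (k - 1) / w k\<close>. Taking \<open>k \<ge> 2\<close>
  keeps the numerator away from \<open>w 0\<close>, for which only nonnegativity is
  available.\<close>

lemma cont_frac_pos:
  assumes TN: "totally_nonneg (T_mat a b c N)" and det: "det (T_mat a b c N) \<noteq> 0"
    and a: "\<And>n. 2 \<le> n \<Longrightarrow> n \<le> N \<Longrightarrow> a n > 0"
    and k: "d + k = N" "2 \<le> k"
  shows "cont_frac (L_sub1 a b c N) (L_sub2 a b c N) d k > 0"
proof -
  define w where "w = last_col_minor a b c N"
  have pos: "lead_minor a b c N k > 0" if "k \<le> N + 1" for k
    using lead_minor_pos[OF TN det that] .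
  have rec: "w j = L_sub1 a b c N (j + 1) * w (j + 1) - L_sub2 a b c N (j + 2) * w (j + 2)"
    if "j < N" for j
    unfolding w_def by (rule last_col_minor_rec[OF pos that])
  have w: "w j > 0" if "1 \<le> j" "j \<le> N" for j
    using rec _ _ _ that
  proof (rule three_term_rec_pos)
    show "w j \<ge> 0" for j
      unfolding w_def by (rule last_col_minor_nonneg[OF TN])
    show "w N > 0"
      using pos[of N] by (simp add: w_def last_col_minor_N)
    show "L_sub2 a b c N n > 0" if "2 \<le> n" "n \<le> N" for n
      using a[OF that] pivot_pos[OF pos, of "n - 2"] that by (simp add: L_sub2_def)
  qed
  have "cont_frac (L_sub1 a b c N) (L_sub2 a b c N) d k = w (k - 1) / w k"
    using rec w k by (intro cont_frac_eq_quotient) (auto simp: w_def last_col_minor_def)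
  then show ?thesis
    using w[of k] w[of "k - 1"] k by simp
qed

section \<open>The splitting of the lower factor\<close>

text \<open>\<open>split_entry m l x n\<close> is \<open>\<alpha>\<^bsub>3n+2\<^esub>\<close>.\<close>

primrec split_entry :: "(nat \<Rightarrow> real) \<Rightarrow> (nat \<Rightarrow> real) \<Rightarrow> real \<Rightarrow> nat \<Rightarrow> real" where
  "split_entry m l x 0 = x"
| "split_entry m l x (Suc n) = l (n + 2) / (m (n + 1) - split_entry m l x n)"

text \<open>The bound by the tail of the fraction carries the induction. It implies the bound by
  \<open>m (n + 1)\<close>, because a tail never exceeds its leading entry, and so the next
  denominator is positive. Index 0 is left out of the positivity claim since \<open>x\<close> may be
  negative.\<close>

lemma split_entry_less_cont_frac:
  assumes x: "x < cont_frac m l (N - 1) 1"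
    and K: "\<And>d k. d + k = N \<Longrightarrow> 2 \<le> k \<Longrightarrow> cont_frac m l d k > 0"
    and l: "\<And>n. 2 \<le> n \<Longrightarrow> n \<le> N \<Longrightarrow> l n > 0"
  shows "n < N \<Longrightarrow> split_entry m l x n < cont_frac m l (N - 1 - n) (n + 1) \<and>
    split_entry m l x n < m (n + 1) \<and> (0 < n \<longrightarrow> split_entry m l x n > 0)"
proof (induction n)
  have less_m: "z < m (n + 1)" if "n < N" "z < cont_frac m l (N - 1 - n) (n + 1)" for n z
  proof (cases "N - 1 - n")
    case 0
    then show ?thesis using that by simp
  next
    case (Suc d)
    then have "cont_frac m l d (n + 2) > 0" "l (n + 2) > 0"
      using that by (auto intro!: K l)
    then have "l (n + 2) / cont_frac m l d (n + 2) > 0"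
      by simp
    then show ?thesis using that Suc by (simp add: numeral_2_eq_2)
  qed
  {
    case 0
    then show ?case
      using x less_m[of 0 x] by simp
  next
    case (Suc n)
    let ?z = "split_entry m l x n" and ?K = "cont_frac m l (N - 1 - Suc n) (Suc n + 1)"
    have l': "l (n + 2) > 0" and K': "?K > 0"
      using Suc.prems by (auto intro!: K l)
    have "N - 1 - n = Suc (N - 1 - Suc n)"
      using Suc.prems by simp
    then have z: "?z < m (n + 1) - l (n + 2) / ?K" "?z < m (n + 1)"
      using Suc.IH Suc.prems by (simp_all add: numeral_2_eq_2)
    \<comment> \<open>All quantities are positive, so exchanging \<open>?K\<close> with the right
      side gives the bound for the next entry.\<close>
    then have "l (n + 2) / ?K < m (n + 1) - ?z"
      by simp
    then have "split_entry m l x (Suc n) < ?K"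
      using l' K' z(2) by (simp add: field_simps)
    moreover have "split_entry m l x (Suc n) > 0"
      using l' z(2) by simp
    ultimately show ?case
      using less_m[OF Suc.prems] by simp
  }
qed

section \<open>Scalar form and uniqueness of the factorization\<close>

lemma bidiag_factorization_iff:
  "bidiag_factorization a b c N x \<alpha> \<longleftrightarrow>
     \<alpha> 2 = x \<and> (\<forall>i\<in>{1..3 * N + 1} - {2}. \<alpha> i > 0) \<and> c 0 = \<alpha> 1 \<and>
     (\<forall>n\<in>{1..N}. c n = \<alpha> (3 * n - 1) + \<alpha> (3 * n) + \<alpha> (3 * n + 1) \<and>
        b n = (\<alpha> (3 * n - 1) + \<alpha> (3 * n)) * \<alpha> (3 * (n - 1) + 1) +
          (if n = 1 then 0 else \<alpha> (3 * n - 1) * \<alpha> (3 * (n - 1)))) \<and>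
     (\<forall>n\<in>{2..N}. a n = \<alpha> (3 * n - 1) * \<alpha> (3 * (n - 1)) * \<alpha> (3 * (n - 2) + 1))"
  unfolding bidiag_factorization_def L1_mat_def L2_mat_def U_mat_def bidiag_product_eq_T_mat_iff
  by simp

text \<open>The entries are recovered row by row: \<open>a n\<close> determines
  \<open>\<alpha> (3 * n - 1)\<close> (for \<open>n = 1\<close> it is \<open>x\<close>), then
  \<open>b n\<close> determines \<open>\<alpha> (3 * n)\<close>, then \<open>c n\<close> determines
  \<open>\<alpha> (3 * n + 1)\<close>. Positivity of the earlier entries permits the
  divisions.\<close>

lemma bidiag_factorization_unique:
  assumes \<alpha>: "bidiag_factorization a b c N x \<alpha>" and \<beta>: "bidiag_factorization a b c N x \<beta>"
  shows "\<forall>i\<in>{1..3 * N + 1}. \<beta> i = \<alpha> i"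
proof -
  have \<alpha>_pos: "\<alpha> i > 0" and \<beta>_pos: "\<beta> i > 0" if "1 \<le> i" "i \<le> 3 * N + 1" "i \<noteq> 2" for i
    using \<alpha> \<beta> that by (auto simp: bidiag_factorization_def)
  note A = \<alpha>[unfolded bidiag_factorization_iff] and B = \<beta>[unfolded bidiag_factorization_iff]
  have main: "\<beta> (3 * n + 1) = \<alpha> (3 * n + 1) \<and>
      (1 \<le> n \<longrightarrow> \<beta> (3 * n - 1) = \<alpha> (3 * n - 1) \<and> \<beta> (3 * n) = \<alpha> (3 * n))" if "n \<le> N" for n
    using that
  proof (induction n rule: less_induct)
    case (less n)
    show ?case
    proof (cases "n = 0")
      case True
      then show ?thesis using A B by simp
    next
      case False
      then have n: "1 \<le> n" "n \<in> {1..N}"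
        using less.prems by auto
      have p: "\<beta> (3 * (n - 1) + 1) = \<alpha> (3 * (n - 1) + 1)" "\<alpha> (3 * (n - 1) + 1) > 0"
        using less.IH[of "n - 1"] n less.prems \<alpha>_pos[of "3 * (n - 1) + 1"] by auto
      have s: "\<beta> (3 * n - 1) = \<alpha> (3 * n - 1)"
      proof (cases "n = 1")
        case True
        then show ?thesis using A B by simp
      next
        case False
        then have n2: "n \<in> {2..N}" using n by simp
        have "\<beta> (3 * (n - 1)) = \<alpha> (3 * (n - 1))" "\<beta> (3 * (n - 2) + 1) = \<alpha> (3 * (n - 2) + 1)"
          using less.IH[of "n - 1"] less.IH[of "n - 2"] n2 by auto
        moreover have "\<alpha> (3 * (n - 1)) > 0" "\<alpha> (3 * (n - 2) + 1) > 0"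
          using n2 by (auto intro!: \<alpha>_pos)
        moreover have "a n = \<alpha> (3 * n - 1) * \<alpha> (3 * (n - 1)) * \<alpha> (3 * (n - 2) + 1)"
          "a n = \<beta> (3 * n - 1) * \<beta> (3 * (n - 1)) * \<beta> (3 * (n - 2) + 1)"
          using A B n2 by blast+
        ultimately show ?thesis
          by simp
      qed
      have bc: "c n = \<alpha> (3 * n - 1) + \<alpha> (3 * n) + \<alpha> (3 * n + 1)"
        "c n = \<beta> (3 * n - 1) + \<beta> (3 * n) + \<beta> (3 * n + 1)"
        "b n = (\<alpha> (3 * n - 1) + \<alpha> (3 * n)) * \<alpha> (3 * (n - 1) + 1) +
          (if n = 1 then 0 else \<alpha> (3 * n - 1) * \<alpha> (3 * (n - 1)))"
        "b n = (\<beta> (3 * n - 1) + \<beta> (3 * n)) * \<beta> (3 * (n - 1) + 1) +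
          (if n = 1 then 0 else \<beta> (3 * n - 1) * \<beta> (3 * (n - 1)))"
        using A B n(2) by blast+
      have "(if n = 1 then 0 else \<beta> (3 * n - 1) * \<beta> (3 * (n - 1))) =
          (if n = 1 then 0 else \<alpha> (3 * n - 1) * \<alpha> (3 * (n - 1)))"
        using s less.IH[of "n - 1"] n less.prems by auto
      then have "(\<beta> (3 * n - 1) + \<beta> (3 * n)) * \<alpha> (3 * (n - 1) + 1) =
          (\<alpha> (3 * n - 1) + \<alpha> (3 * n)) * \<alpha> (3 * (n - 1) + 1)"
        using bc(3) bc(4)[unfolded p(1)] by linarith
      then have "\<beta> (3 * n) = \<alpha> (3 * n)"
        using p(2) s by simp
      moreover have "\<beta> (3 * n + 1) = \<alpha> (3 * n + 1)"
        using bc(1,2) s \<open>\<beta> (3 * n) = \<alpha> (3 * n)\<close> by linarith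
      ultimately show ?thesis using s by simp
    qed
  qed
  show ?thesis
  proof
    fix i assume i: "i \<in> {1..3 * N + 1}"
    consider n where "i = 3 * n + 1" | n where "1 \<le> n" "i = 3 * n - 1" | n where "1 \<le> n" "i = 3 * n"
    proof -
      have "i = 3 * (i div 3) + i mod 3" "i mod 3 < 3" by simp_all
      then have "i = 3 * (i div 3) + 1 \<or> i = 3 * Suc (i div 3) - 1 \<or> (1 \<le> i div 3 \<and> i = 3 * (i div 3))"
        using i by auto
      then show thesis using that by (metis le_add1 plus_1_eq_Suc)
    qed
    then show "\<beta> i = \<alpha> i"
      using main i by cases auto
  qed
qed

theorem theorem7:
  fixes N :: nat and a b c :: "nat \<Rightarrow> real" and \<alpha>\<^sub>2 :: real
  assumes "N \<ge> 1"
    and "\<forall>n\<in>{2..N}. a n > 0"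
    and "oscillatory (T_mat a b c N)"
    and "\<alpha>\<^sub>2 < K_frac a b c N"
  shows "\<exists>\<alpha> :: nat \<Rightarrow> real.
           bidiag_factorization a b c N \<alpha>\<^sub>2 \<alpha> \<and>
           (\<forall>\<beta>. bidiag_factorization a b c N \<alpha>\<^sub>2 \<beta> \<longrightarrow> (\<forall>i\<in>{1..3 * N + 1}. \<beta> i = \<alpha> i)) \<and>
           (\<forall>n\<le>N. \<alpha> (3 * n + 1) = pivot a b c N n) \<and>
           (\<alpha>\<^sub>2 \<ge> 0 \<longrightarrow> InTN (L1_mat N \<alpha>) \<and> InTN (L2_mat N \<alpha>) \<and> InTN (U_mat N \<alpha>))"
proof -
  define m l p z where "m = L_sub1 a b c N" and "l = L_sub2 a b c N" and "p = pivot a b c N"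
    and "z = split_entry m l \<alpha>\<^sub>2"
  have TN: "totally_nonneg (T_mat a b c N)"
    using assms(3) by (simp add: oscillatory_def)
  have det: "det (T_mat a b c N) \<noteq> 0"
    using oscillatory_det_nonzero[OF assms(3) T_mat_carrier] .
  have a: "a n > 0" if "2 \<le> n" "n \<le> N" for n
    using assms(2) that by simp
  have lead: "lead_minor a b c N k > 0" if "k \<le> N + 1" for k
    using lead_minor_pos[OF TN det that] .
  have p: "p n > 0" if "n \<le> N" for n
    unfolding p_def by (rule pivot_pos[OF lead that])
  have l: "l n > 0" if "2 \<le> n" "n \<le> N" for n
    using a[OF that] p[of "n - 2"] that by (simp add: l_def p_def L_sub2_def)
  \<comment> \<open>The first bound becomes positivity of \<open>\<alpha> (3 * (n + 1))\<close>, the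
    second that of \<open>\<alpha> (3 * n + 2)\<close>.\<close>
  have z: "z n < m (n + 1) \<and> (0 < n \<longrightarrow> z n > 0)" if "n < N" for n
    using split_entry_less_cont_frac[of \<alpha>\<^sub>2 m l N n] that assms(4) l cont_frac_pos[OF TN det a]
    by (simp add: K_frac_def z_def m_def l_def)
  have zl: "z (Suc n) * (m (n + 1) - z n) = l (n + 2)" if "n < N" for n
    using z[OF that] by (simp add: z_def)
  \<comment> \<open>The three sequences are interleaved by residue modulo 3. The index
    \<open>i div 3 - 1\<close> truncates only at \<open>i = 0\<close>, which no factor uses.\<close>
  define \<alpha> where "\<alpha> i = (if i mod 3 = 1 then p (i div 3) else if i mod 3 = 2 then z (i div 3)
    else m (i div 3) - z (i div 3 - 1))" for i
  have \<alpha>1: "\<alpha> (3 * n + 1) = p n" and \<alpha>2: "\<alpha> (3 * n + 2) = z n"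
    and \<alpha>0: "\<alpha> (3 * n) = m n - z (n - 1)" for n
  proof -
    have "(3 * n + 1) mod 3 = 1" "(3 * n + 1) div 3 = n" "(3 * n + 2) mod 3 = 2" "(3 * n + 2) div 3 = n"
      by presburger+
    then show "\<alpha> (3 * n + 1) = p n" "\<alpha> (3 * n + 2) = z n" "\<alpha> (3 * n) = m n - z (n - 1)"
      unfolding \<alpha>_def by simp_all
  qed
  have \<alpha>m: "\<alpha> (3 * n - 1) = z (n - 1)" if "1 \<le> n" for n
    using \<alpha>2[of "n - 1"] that by (cases n) simp_all
  have \<alpha>_2: "\<alpha> 2 = \<alpha>\<^sub>2"
    using \<alpha>2[of 0] by (simp add: z_def numeral_2_eq_2)
  have pos: "\<alpha> i > 0" if i: "i \<in> {1..3 * N + 1} - {2}" for i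
  proof -
    have "i = 3 * (i div 3) + i mod 3" "i mod 3 < 3" by simp_all
    then consider n where "i = 3 * n + 1" | n where "i = 3 * n + 2" | n where "i = 3 * n"
      by (metis One_nat_def add.right_neutral less_2_cases less_Suc_eq numeral_2_eq_2 numeral_3_eq_3)
    then show ?thesis
    proof cases
      case (1 n)
      then show ?thesis using i \<alpha>1 p by simp
    next
      case (2 n)
      then show ?thesis using i \<alpha>2[of n] z[of n] by auto
    next
      case (3 n)
      then show ?thesis using i \<alpha>0[of n] z[of "n - 1"] by auto
    qed
  qed
  have fact: "bidiag_factorization a b c N \<alpha>\<^sub>2 \<alpha>"
    unfolding bidiag_factorization_iff
  proof (intro conjI ballI)
    show "c 0 = \<alpha> 1"
      using \<alpha>1[of 0] by (simp add: p_def pivot_def lead_minor_1)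
    fix n assume n: "n \<in> {1..N}"
    show "c n = \<alpha> (3 * n - 1) + \<alpha> (3 * n) + \<alpha> (3 * n + 1)"
      using \<alpha>m[of n] \<alpha>0[of n] \<alpha>1[of n] n diag_eq_L_sub1[of c n a b N] by (simp add: m_def p_def)
    \<comment> \<open>The relation \<open>zl\<close> at \<open>n - 2\<close> identifies the mixed
      term in \<open>b n\<close> with \<open>l n\<close>.\<close>
    have "(if n = 1 then 0 else l n) = (if n = 1 then 0 else \<alpha> (3 * n - 1) * \<alpha> (3 * (n - 1)))"
      using zl[of "n - 2"] \<alpha>m[of n] \<alpha>0[of "n - 1"] n by (cases n; cases "n - 1") auto
    then show "b n = (\<alpha> (3 * n - 1) + \<alpha> (3 * n)) * \<alpha> (3 * (n - 1) + 1) +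
        (if n = 1 then 0 else \<alpha> (3 * n - 1) * \<alpha> (3 * (n - 1)))"
      using sub1_eq_L_sub[OF lead, of n] \<alpha>m[of n] \<alpha>0[of n] \<alpha>1[of "n - 1"] n
      by (cases "n = 1") (simp_all add: m_def p_def l_def)
  next
    fix n assume n: "n \<in> {2..N}"
    then have "l n = \<alpha> (3 * n - 1) * \<alpha> (3 * (n - 1))"
      using zl[of "n - 2"] \<alpha>m[of n] \<alpha>0[of "n - 1"] by (cases n; cases "n - 1") auto
    then show "a n = \<alpha> (3 * n - 1) * \<alpha> (3 * (n - 1)) * \<alpha> (3 * (n - 2) + 1)"
      using sub2_eq_L_sub2[OF lead, of n] \<alpha>1[of "n - 2"] n by (simp add: l_def p_def)
  qed (use \<alpha>_2 pos in auto)
  \<comment> \<open>Among the subdiagonal entries only \<open>\<alpha> 2\<close> is not yet known to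
    be positive; it equals \<open>\<alpha>\<^sub>2\<close>.\<close>
  have "InTN (L1_mat N \<alpha>)" if "\<alpha>\<^sub>2 \<ge> 0"
    unfolding L1_mat_def
  proof (rule InTN_lower_unibidiag)
    fix n assume "1 \<le> n" "n \<le> N"
    then have "3 * n - 1 \<in> {1..3 * N + 1}"
      by auto
    then show "\<alpha> (3 * n - 1) \<ge> 0"
      using pos[of "3 * n - 1"] \<alpha>_2 that by (cases "3 * n - 1 = 2") auto
  qed
  moreover have "InTN (L2_mat N \<alpha>)"
    unfolding L2_mat_def
  proof (rule InTN_lower_unibidiag)
    fix n assume "1 \<le> n" "n \<le> N"
    moreover have "3 * n \<noteq> 2"
      by presburger
    ultimately show "\<alpha> (3 * n) \<ge> 0"
      using pos[of "3 * n"] by simp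
  qed
  moreover have "InTN (U_mat N \<alpha>)"
    unfolding U_mat_def by (rule InTN_upper_bidiag) (simp add: \<alpha>1[simplified] p)
  ultimately show ?thesis
    using fact bidiag_factorization_unique[OF fact] \<alpha>1 by (intro exI[of _ \<alpha>]) (auto simp: p_def)
qed

end
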